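(* Let $p:\mathbb{N}\times\mathbb{N}\to\mathbb{N}\setminus\{0\}$ be a bijection, and define $p_\Delta:\mathbb{N}\times\mathbb{N}\to\mathbb{N}$ by $p_\Delta(x,y)=p(x,y)$ if $x>y$ and $p_\Delta(x,y)=0$ otherwise. Then the binary clone $T_1$ of all almost unary functions is generated by $\{p_\Delta\}\cup\mathcal{O}^{(1)}$; that is, $T_1$ is the smallest binary clone containing $p_\Delta$ and $\mathcal{O}^{(1)}$.
   Context: $\mathbb{N}=\{0,1,2,\dots\}$. A binary clone (on $\mathbb{N}$) is a set $\mathcal{C}$ of functions $f:\mathbb{N}^2\to\mathbb{N}$ which contains the two projections $(x,y)\mapsto x$, $(x,y)\mapsto y$ and is closed under composition: if $f,g,h\in\mathcal{C}$, then the function $(x,y)\mapsto f(g(x,y),h(x,y))$ is in $\mathcal{C}$. $\mathcal{O}^{(1)}$ denotes the set of unary functions $u:\mathbb{N}\to\mathbb{N}$, identified with the set of essentially unary functions; thus, for binary clones, "containing $\mathcal{O}^{(1)}$" means containing all functions $(x,y)\mapsto u(x)$ and $(x,y)\mapsto u(y)$ with $u:\mathbb{N}\to\mathbb{N}$ arbitrary. A function $f:\mathbb{N}\times\mathbb{N}\to\mathbb{N}$ is almost unary if at least one of the following holds: (x) there is $F:\mathbb{N}\to\mathbb{N}$ with $f(x,y)\le F(x)$ for all $x,y$; (y) there is $F:\mathbb{N}\to\mathbb{N}$ with $f(x,y)\le F(y)$ for all $x,y$. $T_1$ is the set of all almost unary functions; it is a binary clone containing $\mathcal{O}^{(1)}$.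 *)

theory Defs
  imports Main
begin

text \<open>Binary functions on the natural numbers (which include 0) are represented in curried form.\<close>

definition binary_clone :: "(nat \<Rightarrow> nat \<Rightarrow> nat) set \<Rightarrow> bool" where
  "binary_clone C \<longleftrightarrow>
     (\<lambda>x y. x) \<in> C \<and> (\<lambda>x y. y) \<in> C \<and>
     (\<forall>f\<in>C. \<forall>g\<in>C. \<forall>h\<in>C. (\<lambda>x y. f (g x y) (h x y)) \<in> C)"

definition generated_clone :: "(nat \<Rightarrow> nat \<Rightarrow> nat) set \<Rightarrow> (nat \<Rightarrow> nat \<Rightarrow> nat) set" where
  "generated_clone S = \<Inter>{C. binary_clone C \<and> S \<subseteq> C}"

lemma binary_clone_generated_clone: "binary_clone (generated_clone S)"
  unfolding binary_clone_def generated_clone_def by simp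

lemma generated_clone_superset: "S \<subseteq> generated_clone S"
  unfolding generated_clone_def by blast

lemma generated_clone_least: "binary_clone C \<Longrightarrow> S \<subseteq> C \<Longrightarrow> generated_clone S \<subseteq> C"
  unfolding generated_clone_def by blast

text \<open>The unary functions, identified with the essentially unary binary functions.\<close>

definition unary_functions :: "(nat \<Rightarrow> nat \<Rightarrow> nat) set" where
  "unary_functions = {(\<lambda>x y. u x) | u. True} \<union> {(\<lambda>x y. u y) | u. True}"

definition almost_unary :: "(nat \<Rightarrow> nat \<Rightarrow> nat) \<Rightarrow> bool" where
  "almost_unary f \<longleftrightarrow>
     (\<exists>F :: nat \<Rightarrow> nat. \<forall>x y. f x y \<le> F x) \<or> (\<exists>F :: nat \<Rightarrow> nat. \<forall>x y. f x y \<le> F y)"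

definition T1 :: "(nat \<Rightarrow> nat \<Rightarrow> nat) set" where
  "T1 = {f. almost_unary f}"

definition p_Delta :: "(nat \<Rightarrow> nat \<Rightarrow> nat) \<Rightarrow> nat \<Rightarrow> nat \<Rightarrow> nat" where
  "p_Delta p x y = (if x > y then p x y else 0)"

end

(* If f x y \<le> F x, then f is recovered by cases on x \<le> y. The term p_Delta (Suc y) x codes (x, y)
   for x \<le> y and vanishes otherwise, while p_Delta x y codes (x, y) for x > y and vanishes otherwise.
   So every function supported on one of the two halves is available directly. The halves are glued
   by two further applications of p_Delta: a value f x y + 1 is inserted once as second argument
   below the bound F x + 2 (case x \<le> y) and once below the result of the first step (case x > y).
   A second argument 0 marks the wrong case, so that one decoder, p a b \<mapsto> if b = 0 then a else b,
   works at both levels. *)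

theory Submission
  imports Defs
begin

lemma binary_clone_comp:
  "binary_clone C \<Longrightarrow> f \<in> C \<Longrightarrow> g \<in> C \<Longrightarrow> h \<in> C \<Longrightarrow> (\<lambda>x y. f (g x y) (h x y)) \<in> C"
  unfolding binary_clone_def by blast

lemma binary_clone_swap:
  assumes "binary_clone C" "f \<in> C"
  shows "(\<lambda>x y. f y x) \<in> C"
  using binary_clone_comp[OF assms, of "\<lambda>x y. y" "\<lambda>x y. x"] assms(1)
  unfolding binary_clone_def by simp

lemma binary_clone_unary_comp:
  assumes "binary_clone C" "unary_functions \<subseteq> C" "g \<in> C"
  shows "(\<lambda>x y. u (g x y)) \<in> C"
proof -
  have "(\<lambda>x y. u x) \<in> C"
    using assms(2) unfolding unary_functions_def by auto
  from binary_clone_comp[OF assms(1) this assms(3) assms(3)] show ?thesis .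
qed

lemma almost_unary_fstI: "(\<And>x y. f x y \<le> F x) \<Longrightarrow> almost_unary f"
  unfolding almost_unary_def by blast

lemma almost_unary_sndI: "(\<And>x y. f x y \<le> F y) \<Longrightarrow> almost_unary f"
  unfolding almost_unary_def by blast

text \<open>The bound on \<open>f\<close> sees one argument only; the bound on the function inserted
  there passes to the composition.\<close>

lemma almost_unary_comp:
  assumes "almost_unary f" "almost_unary g" "almost_unary h"
  shows "almost_unary (\<lambda>x y. f (g x y) (h x y))"
proof -
  have bounded: "almost_unary (\<lambda>x y. k x y)"
    if k: "\<And>x y. k x y \<le> F (a x y)" and a: "almost_unary a"
    for k a :: "nat \<Rightarrow> nat \<Rightarrow> nat" and F :: "nat \<Rightarrow> nat"
  proof -
    \<comment> \<open>\<open>F\<close> may fail to be monotone, so it is replaced by its running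
      maximum.\<close>
    have F: "F m \<le> Max (F ` {..n})" if "m \<le> n" for m n
      using that by (intro Max_ge) auto
    from a consider A where "\<And>x y. a x y \<le> A x" | A where "\<And>x y. a x y \<le> A y"
      unfolding almost_unary_def by blast
    then show ?thesis
    proof cases
      case 1
      then have "k x y \<le> Max (F ` {..A x})" for x y
        using k F order_trans by blast
      then show ?thesis by (rule almost_unary_fstI)
    next
      case 2
      then have "k x y \<le> Max (F ` {..A y})" for x y
        using k F order_trans by blast
      then show ?thesis by (rule almost_unary_sndI)
    qed
  qed
  from assms(1) consider F where "\<And>x y. f x y \<le> F x" | F where "\<And>x y. f x y \<le> F y"
    unfolding almost_unary_def by blast
  then show ?thesis
  proof cases
    case 1
    from bounded[OF this assms(2)] show ?thesis .
  next
    case 2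
    from bounded[OF this assms(3)] show ?thesis .
  qed
qed

lemma binary_clone_T1: "binary_clone T1"
proof -
  have "almost_unary (\<lambda>x y. x)" "almost_unary (\<lambda>x y. y)"
    by (rule almost_unary_fstI[of _ "\<lambda>n. n"] almost_unary_sndI[of _ "\<lambda>n. n"], simp)+
  then show ?thesis
    unfolding binary_clone_def T1_def using almost_unary_comp by simp
qed

text \<open>For fixed \<open>x\<close>, nonzero values occur only at the finitely many
  \<open>y < x\<close>.\<close>

lemma p_Delta_in_T1: "p_Delta p \<in> T1"
proof -
  have "p_Delta p x y \<le> Max (p x ` {..x})" for x y
    unfolding p_Delta_def by (auto intro: Max_ge)
  then have "almost_unary (p_Delta p)" by (rule almost_unary_fstI)
  then show ?thesis unfolding T1_def by simp
qed

lemma unary_functions_subset_T1: "unary_functions \<subseteq> T1"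
  unfolding unary_functions_def T1_def almost_unary_def by blast

lemma bounded_in_clone:
  assumes p: "bij_betw (\<lambda>(x, y). p x y) (UNIV \<times> UNIV) (UNIV - {0::nat})"
    and C: "binary_clone C" "unary_functions \<subseteq> C" "p_Delta p \<in> C"
    and f: "\<And>x y. f x y \<le> F x"
  shows "f \<in> C"
proof -
  note unary = binary_clone_unary_comp[OF C(1,2)]
  note pD = binary_clone_comp[OF C(1) C(3)]
  have proj: "(\<lambda>x y. x) \<in> C" "(\<lambda>x y. y) \<in> C"
    using C(1) unfolding binary_clone_def by auto
  \<comment> \<open>0 is not a value of \<open>p\<close>, so \<open>q 0\<close> carries no
    information; \<open>v\<close> and \<open>w\<close> send 0 to 0 to keep it as the mark.\<close>
  define q where "q = inv_into UNIV (\<lambda>(x, y). p x y)"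
  have q: "q (p a b) = (a, b)" for a b
    using inv_into_f_f[of "\<lambda>(x, y). p x y" UNIV "(a, b)"] p
    by (simp add: q_def bij_betw_def)
  have pos: "p a b \<noteq> 0" for a b
    using bij_betwE[OF p] by auto
  \<comment> \<open>The code read here is \<open>p (Suc y) x\<close>, hence the swapped arguments
    and \<open>a - 1\<close>; \<open>Suc y\<close> puts the diagonal into this half.\<close>
  define v where "v n = (if n = 0 then 0 else case q n of (a, b) \<Rightarrow> Suc (f b (a - 1)))" for n
  define w where "w n = (if n = 0 then 0 else case q n of (a, b) \<Rightarrow> Suc (f a b))" for n
  define u where "u n = (case q n of (a, b) \<Rightarrow> if b = 0 then a else b)" for n
  \<comment> \<open>Since \<open>f x y + 1 < F x + 2\<close>, the outer \<open>p_Delta p\<close>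
    never vanishes and \<open>u\<close> receives a genuine code.\<close>
  define D where "D x y = u (p_Delta p (F x + 2) (v (p_Delta p (Suc y) x)))" for x y
  have "D \<in> C"
    unfolding D_def
    by (intro unary[where u = u] unary[where u = v] pD proj
        unary[where u = "\<lambda>n. F n + 2"] unary[where u = Suc])
  then have "(\<lambda>x y. u (p_Delta p (D x y) (w (p_Delta p x y))) - 1) \<in> C"
    by (intro unary[where u = "\<lambda>n. u n - 1"] pD unary[where u = w] proj)
  moreover have "u (p_Delta p (D x y) (w (p_Delta p x y))) - 1 = f x y" for x y
  proof -
    have le: "f x y < Suc (F x)"
      using f by (simp add: le_imp_less_Suc)
    \<comment> \<open>For \<open>x > y\<close> the leftover \<open>F x + 2\<close> lies above
      \<open>Suc (f x y)\<close>, so the second comparison succeeds too; for x \<le> y it compares a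
      positive number with 0.\<close>
    have "D x y = (if x \<le> y then Suc (f x y) else F x + 2)"
      using le unfolding D_def by (simp add: p_Delta_def v_def u_def q pos)
    then show ?thesis
      using le by (simp add: p_Delta_def w_def u_def q pos)
  qed
  ultimately show ?thesis by simp
qed

theorem mainTheorem1:
  fixes p :: "nat \<Rightarrow> nat \<Rightarrow> nat"
  assumes "bij_betw (\<lambda>(x, y). p x y) (UNIV \<times> UNIV) (UNIV - {0})"
  shows "T1 = generated_clone ({p_Delta p} \<union> unary_functions)"
proof
  let ?C = "generated_clone ({p_Delta p} \<union> unary_functions)"
  show "?C \<subseteq> T1"
    using p_Delta_in_T1 unary_functions_subset_T1
    by (intro generated_clone_least binary_clone_T1) auto
  have C: "binary_clone ?C" "unary_functions \<subseteq> ?C" "p_Delta p \<in> ?C"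
    using binary_clone_generated_clone generated_clone_superset by blast+
  note bounded = bounded_in_clone[OF assms C]
  show "T1 \<subseteq> ?C"
  proof
    fix f assume "f \<in> T1"
    then consider F where "\<And>x y. f x y \<le> F x" | F where "\<And>x y. f x y \<le> F y"
      unfolding T1_def almost_unary_def by blast
    then show "f \<in> ?C"
    proof cases
      case 1
      then show ?thesis by (rule bounded)
    next
      case 2
      \<comment> \<open>Exchanging the variables turns the bound in \<open>y\<close> into a bound in
        \<open>x\<close>.\<close>
      then have "(\<lambda>x y. f y x) \<in> ?C" by (rule bounded)
      from binary_clone_swap[OF C(1) this] show ?thesis .
    qed
  qed
qed

end
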